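(* For all $n\ge 1$, let $m$ satisfy $2f_m\le n<2f_{m+1}$. Then $$A(n)=\begin{cases} n-f_{m-1}-2, & \text{if } n\le f_{m+1}+2f_{m-1}-1;\\ f_{m+1}+f_{m-1}-3, & \text{otherwise.}\end{cases}$$
   Context: The Fibonacci sequence $\mathbb{F}$ is the infinite word over $\{a,b\}$ that is the fixed point beginning with $a$ of the morphism $\sigma(a)=ab$, $\sigma(b)=a$; $\mathbb{F}[1,n]$ is its prefix of length $n$. The notation $u\prec v$ means that $u$ is a factor (contiguous subword) of $v$. $A(n)=\sharp\{\omega:\omega\omega\prec\mathbb{F}[1,n]\}$, where $\omega$ ranges over nonempty words, is the number of distinct squares in $\mathbb{F}[1,n]$. The Fibonacci numbers are indexed by $f_{-2}=0$, $f_{-1}=1$, $f_{m+1}=f_m+f_{m-1}$ for $m\ge -1$ (so $f_0=1$, $f_1=2$, $f_2=3$, $f_3=5$).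
   Formalization: The formula is claimed only for n ≥ 3; at n = 2 (m = 0) it would give −1 although A(2) = 0, and at n = 1 (m = −2) it involves the undefined f_{−3}; for n = 1, 2 the true value A(n) = 0 is stated instead. *)

theory Defs
  imports "HOL-Library.Stream" "HOL-Library.Sublist" "HOL-Number_Theory.Fib"
begin

datatype letter = La | Lb

fun fib_morphism :: "letter \<Rightarrow> letter list" where
  "fib_morphism La = [La, Lb]"
| "fib_morphism Lb = [La]"

text \<open>
  The extension of the morphism to infinite words: replace every letter by its image and
  concatenate the results (\<^const>\<open>flat\<close> is concatenation of a stream of nonempty lists).
\<close>

definition fib_morphism_inf :: "letter stream \<Rightarrow> letter stream" where
  "fib_morphism_inf s = flat (smap fib_morphism s)"

text \<open>
  The description below is proper: lemma \<open>ex1_fib_word\<close> shows that there is exactly one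
  such infinite word.
\<close>

definition fib_word :: "letter stream" where
  "fib_word = (THE s. shd s = La \<and> fib_morphism_inf s = s)"

text \<open>
  The Fibonacci numbers with index shifted by two, so that the sequence starts
  \<open>0, 1, 1, 2, 3, 5\<close> at index \<open>-2\<close>. Values at indices below \<open>-2\<close> are meaningless.
\<close>

definition fibn :: "int \<Rightarrow> int" where
  "fibn m = int (fib (nat (m + 2)))"

text \<open>
  The set counted here is finite, because \<open>w\<close> is a factor of a finite word, so \<^const>\<open>card\<close> is the
  true number of elements. The prefix of length \<open>n\<close> is \<open>stake n fib_word\<close>, and
  \<^const>\<open>sublist\<close> is the contiguous-factor relation.
\<close>

definition num_squares :: "nat \<Rightarrow> nat" where
  "num_squares n = card {w. w \<noteq> [] \<and> sublist (w @ w) (stake n fib_word)}"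

lemma finite_squares: "finite {w. w \<noteq> [] \<and> sublist (w @ w) (stake n fib_word)}"
proof (rule finite_subset)
  show "{w. w \<noteq> [] \<and> sublist (w @ w) (stake n fib_word)} \<subseteq> set (sublists (stake n fib_word))"
    by (auto simp: sublist_def) (metis append.assoc)
qed simp

lemma fibn_init: "fibn (-2) = 0" "fibn (-1) = 1"
  by (simp_all add: fibn_def)

lemma fibn_rec:
  assumes "m \<ge> -1"
  shows "fibn (m + 1) = fibn m + fibn (m - 1)"
proof -
  define k where "k = nat (m + 1)"
  have m: "m = int k - 1" using assms by (simp add: k_def)
  have "nat (m + 1 + 2) = Suc (Suc k)" "nat (m + 2) = Suc k" "nat (m - 1 + 2) = k"
    unfolding m by auto
  then show ?thesis by (simp add: fibn_def)
qed

lemma fib_morphism_nonempty: "fib_morphism x \<noteq> []"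
  by (cases x) auto

lemma fib_morphism_inf_shift:
  "fib_morphism_inf (xs @- s) = concat (map fib_morphism xs) @- fib_morphism_inf s"
  by (induction xs) (simp_all add: fib_morphism_inf_def fib_morphism_nonempty)

text \<open>The finite approximations: iterated images of the letter \<open>a\<close>.\<close>

definition fib_approx :: "nat \<Rightarrow> letter list" where
  "fib_approx k = ((\<lambda>xs. concat (map fib_morphism xs)) ^^ k) [La]"

lemma fib_approx_Suc: "fib_approx (Suc k) = concat (map fib_morphism (fib_approx k))"
  by (simp add: fib_approx_def)

lemma fib_approx_step: "\<exists>ys. ys \<noteq> [] \<and> fib_approx (Suc k) = fib_approx k @ ys"
proof (induction k)
  case 0
  show ?case by (auto simp: fib_approx_def)
next
  case (Suc k)
  then obtain ys where ys: "ys \<noteq> []" "fib_approx (Suc k) = fib_approx k @ ys" by blast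
  have "fib_approx (Suc (Suc k)) = fib_approx (Suc k) @ concat (map fib_morphism ys)"
    by (subst fib_approx_Suc, subst ys(2)) (simp add: fib_approx_Suc)
  moreover have "concat (map fib_morphism ys) \<noteq> []"
    using ys(1) by (cases ys) (auto simp: fib_morphism_nonempty)
  ultimately show ?case by blast
qed

lemma fib_approx_length: "k < length (fib_approx k)"
proof (induction k)
  case 0
  show ?case by (simp add: fib_approx_def)
next
  case (Suc k)
  then show ?case using fib_approx_step[of k] by (auto simp: neq_Nil_conv)
qed

lemma fib_approx_prefix: "k \<le> l \<Longrightarrow> prefix (fib_approx k) (fib_approx l)"
proof (induction rule: dec_induct)
  case (step n)
  then show ?case using fib_approx_step[of n] by (auto simp: prefix_def)
qed simp

lemma fib_approx_nth:
  "i < length (fib_approx k) \<Longrightarrow> i < length (fib_approx l) \<Longrightarrow> fib_approx k ! i = fib_approx l ! i"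
  using fib_approx_prefix[of k l] fib_approx_prefix[of l k]
  by (cases "k \<le> l") (auto simp: prefix_def nth_append)

lemma fixed_point_snth:
  assumes "shd s = La" "fib_morphism_inf s = s"
  shows "s !! i = fib_approx i ! i"
proof -
  have "\<exists>t. s = fib_approx k @- t" for k
  proof (induction k)
    case 0
    show ?case using assms(1) by (intro exI[of _ "stl s"]) (simp add: fib_approx_def stream.expand)
  next
    case (Suc k)
    then obtain t where "s = fib_approx k @- t" by blast
    then have "s = fib_approx (Suc k) @- fib_morphism_inf t"
      using assms(2) fib_morphism_inf_shift fib_approx_Suc by metis
    then show ?case by blast
  qed
  then obtain t where "s = fib_approx i @- t" by blast
  then show ?thesis using fib_approx_length[of i] by simp
qed

lemma ex1_fib_word: "\<exists>!s. shd s = La \<and> fib_morphism_inf s = s"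
proof -
  define F where "F = smap (\<lambda>i. fib_approx i ! i) nats"
  have nth: "F !! i = fib_approx i ! i" for i by (simp add: F_def)
  have pre: "\<exists>t. F = fib_approx k @- t" for k
  proof -
    have "stake (length (fib_approx k)) F = fib_approx k"
      by (rule nth_equalityI) (auto simp: nth fib_approx_length intro: fib_approx_nth)
    then show ?thesis by (metis stake_sdrop)
  qed
  have eq: "fib_morphism_inf F !! i = F !! i" for i
  proof -
    obtain t where "F = fib_approx i @- t" using pre by blast
    then have "fib_morphism_inf F = fib_approx (Suc i) @- fib_morphism_inf t"
      by (simp add: fib_morphism_inf_shift fib_approx_Suc)
    then have "fib_morphism_inf F !! i = fib_approx (Suc i) ! i"
      using fib_approx_length[of "Suc i"] by simp
    also have "\<dots> = F !! i"
      using fib_approx_length[of "Suc i"] fib_approx_length[of i]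
      by (auto simp: nth intro: fib_approx_nth)
    finally show ?thesis .
  qed
  have ext: "s = t" if "\<And>i. s !! i = t !! i" for s t :: "letter stream"
    using that by (metis stream_smap_nats stream.map_cong)
  have "fib_morphism_inf F = F" using eq ext by blast
  moreover have "shd F = La" using nth[of 0] by (simp add: fib_approx_def)
  ultimately show ?thesis
    using fixed_point_snth ext by (intro ex1I[of _ F]) (auto simp: nth)
qed

lemma fib_word_fixed_point: "shd fib_word = La" "fib_morphism_inf fib_word = fib_word"
  using theI'[OF ex1_fib_word] by (auto simp: fib_word_def)

end

theory Submission
  imports Defs
begin

text \<open>
Write \<open>x\<^sub>k\<close> for \<^const>\<open>fib_approx\<close> \<open>k\<close>, the image of \<open>a\<close> under \<open>k\<close> applications of the morphism, and
\<open>f\<^sub>k\<close> for its length, which is \<open>fib (k + 2)\<close>. Positions in the infinite word start at \<open>0\<close>.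

Squares in the infinite word are rigid: if \<open>ww\<close> is a factor, then \<open>w\<close> is a rotation of some \<open>x\<^sub>k\<close>
(lemma \<open>square_in_fib_approx_conjugate\<close>). Indeed, up to a shift by one letter, a square is the image of
a shorter square under the morphism, apart from two small cases. Conversely the square of every
rotation occurs, and since \<open>x\<^sub>k\<close> is primitive, its \<open>f\<^sub>k\<close> rotations are distinct
(\<open>rotate_fib_approx_inj\<close>). So counting the squares in a prefix amounts to knowing where the square of
each rotation ends for the first time.

A square with root of length \<open>f\<^sub>k\<close> is a stretch on which the infinite word agrees with its shift by \<open>f\<^sub>k\<close>.
As \<open>x\<^sub>k\<^sub>+\<^sub>1 x\<^sub>k\<close> and \<open>x\<^sub>k x\<^sub>k\<^sub>+\<^sub>1\<close> differ in precisely their last two letters, this agreement holds from the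
start, fails at the two positions just before \<open>f\<^sub>k\<^sub>+\<^sub>1\<close> (\<open>fib_word_initial_run\<close>), and holds again from
\<open>f\<^sub>k\<^sub>+\<^sub>1\<close> on for a stretch that exhausts all rotations (\<open>fib_word_second_run\<close>). Both stretches begin
with \<open>x\<^sub>k\<close>. Therefore the square of the \<open>i\<close>-th rotation first ends at \<open>2 f\<^sub>k + i\<close> if
\<open>i < f\<^sub>k\<^sub>-\<^sub>1 - 1\<close>, and at \<open>f\<^sub>k\<^sub>+\<^sub>1 + 2 f\<^sub>k + i\<close> otherwise (\<open>squares_in_fib_prefix\<close>). For \<open>n\<close> between \<open>2 f\<^sub>m\<close> and
\<open>2 f\<^sub>m\<^sub>+\<^sub>1\<close> only the roots of length \<open>f\<^sub>m\<close> and \<open>f\<^sub>m\<^sub>-\<^sub>1\<close> are incompletely represented, and adding up gives the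
formula (\<open>num_squares_window\<close>).
\<close>

section \<open>Fibonacci words\<close>

abbreviation fib_subst :: "letter list \<Rightarrow> letter list" where
  "fib_subst xs \<equiv> concat (map fib_morphism xs)"

lemma fib_approx_0: "fib_approx 0 = [La]"
  by (simp add: fib_approx_def)

lemma fib_approx_1: "fib_approx (Suc 0) = [La, Lb]"
  by (simp add: fib_approx_def)

lemma fib_approx_append: "fib_approx (Suc (Suc k)) = fib_approx (Suc k) @ fib_approx k"
proof (induction k)
  case 0
  show ?case by (simp add: fib_approx_def)
next
  case (Suc k)
  have "fib_approx (Suc (Suc (Suc k))) = fib_subst (fib_approx (Suc (Suc k)))"
    by (rule fib_approx_Suc)
  also have "\<dots> = fib_subst (fib_approx (Suc k)) @ fib_subst (fib_approx k)"
    by (simp only: Suc.IH map_append concat_append)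
  finally show ?case by (simp only: fib_approx_Suc[symmetric])
qed

lemma length_fib_approx: "length (fib_approx k) = fib (k + 2)"
  by (induction k rule: fib.induct)
     (simp_all add: fib_approx_append fib_approx_0 fib_approx_1 add.commute)

lemma count_La_fib_approx: "count_list (fib_approx k) La = fib (k + 1)"
  by (induction k rule: fib.induct)
     (simp_all add: fib_approx_append fib_approx_0 fib_approx_1 add.commute)

text \<open>
The two products of consecutive Fibonacci words have the same length and differ exactly by a
swap of their last two letters. This is the source of every periodicity, and of every
interruption of a periodicity, that is needed below: two occurrences of such products that are
shifted against each other agree until two letters before their end, and there they disagree.
\<close>

lemma fib_approx_almost_commute:
  "\<exists>c u v. u \<noteq> v \<and> fib_approx (Suc k) @ fib_approx k = c @ [u, v] \<and>
           fib_approx k @ fib_approx (Suc k) = c @ [v, u]"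
proof (induction k)
  case 0
  show ?case
    by (rule exI[of _ "[La]"], rule exI[of _ Lb], rule exI[of _ La])
       (simp add: fib_approx_0 fib_approx_1)
next
  case (Suc k)
  then obtain c u v where neq: "u \<noteq> v"
    and uv: "fib_approx (Suc k) @ fib_approx k = c @ [u, v]"
    and vu: "fib_approx k @ fib_approx (Suc k) = c @ [v, u]" by blast
  have "fib_approx (Suc (Suc k)) @ fib_approx (Suc k) = (fib_approx (Suc k) @ c) @ [v, u]"
    by (simp only: fib_approx_append append_assoc vu)
  moreover have "fib_approx (Suc k) @ fib_approx (Suc (Suc k)) = (fib_approx (Suc k) @ c) @ [u, v]"
    by (simp only: fib_approx_append append_assoc uv)
  ultimately show ?case using neq by metis
qed

text \<open>
Fibonacci words are primitive. If two rotations coincide, the word equals a nontrivial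
rotation of itself, so it is the product of two nonempty words that commute, and hence a proper
power; the exponent then divides both its length and its number of letters \<open>a\<close>. These are consecutive Fibonacci numbers, which are coprime.
\<close>

lemma rotate_fib_approx_inj:
  assumes "i < length (fib_approx k)" "j < length (fib_approx k)"
    and "rotate i (fib_approx k) = rotate j (fib_approx k)"
  shows "i = j"
proof -
  have False if ij: "i < j" and j: "j < length (fib_approx k)"
    and eq: "rotate i (fib_approx k) = rotate j (fib_approx k)" for i j
  proof -
    let ?x = "fib_approx k"
    define d where "d = j - i"
    have "rotate (length ?x - i) (rotate i ?x) = rotate (length ?x - i) (rotate j ?x)"
      by (simp only: eq)
    then have "?x = rotate (length ?x + d) ?x"
      using ij j by (simp add: rotate_rotate d_def)
    then have rot: "rotate d ?x = ?x"
      by (simp add: rotate_conv_mod[of "length ?x + d"] flip: rotate_conv_mod)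
    have d: "0 < d" "d < length ?x" using ij j by (auto simp: d_def)
    define xs ys where "xs = take d ?x" and "ys = drop d ?x"
    have x: "?x = xs @ ys" by (simp add: xs_def ys_def)
    have "?x = ys @ xs" using rot d by (simp add: rotate_drop_take xs_def ys_def)
    then have "xs @ ys = ys @ xs" using x by simp
    then obtain m n zs where mn: "concat (replicate m zs) = xs" "concat (replicate n zs) = ys"
      using comm_append_are_replicate by blast
    have "xs \<noteq> []" "ys \<noteq> []" using d by (auto simp: xs_def ys_def)
    then have "m \<noteq> 0" "n \<noteq> 0" using mn by (metis concat.simps(1) replicate_0)+
    have len: "length (concat (replicate r zs)) = r * length zs" for r
      by (induction r) auto
    have cnt: "count_list (concat (replicate r zs)) La = r * count_list zs La" for r
      by (induction r) auto
    have "fib (k + 2) = (m + n) * length zs"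
      using x mn len by (metis length_fib_approx length_append add_mult_distrib)
    moreover have "fib (k + 1) = (m + n) * count_list zs La"
      using x mn cnt by (metis count_La_fib_approx count_list_append add_mult_distrib)
    ultimately have "m + n dvd fib (k + 1)" "m + n dvd fib (Suc (k + 1))" by auto
    then have "m + n dvd 1"
      using coprime_fib_Suc_nat[of "k + 1"] by (meson coprime_common_divisor_nat dvd_1_iff_1 coprime_def)
    then show False using \<open>m \<noteq> 0\<close> \<open>n \<noteq> 0\<close> by auto
  qed
  then show ?thesis using assms by (metis linorder_neqE_nat)
qed

section \<open>Desubstitution\<close>

text \<open>
Synchronisation: in an image under the morphism, every letter other than \<open>b\<close> begins the image of a
letter, so each position not followed by \<open>b\<close> is a boundary between images.
\<close>

lemma fib_subst_cut:
  assumes "fib_subst z = p @ q" and "\<not> prefix [Lb] q"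
  shows "\<exists>z1 z2. z = z1 @ z2 \<and> p = fib_subst z1 \<and> q = fib_subst z2"
  using assms(1)
proof (induction z arbitrary: p)
  case Nil
  then show ?case by auto
next
  case (Cons c z)
  show ?case
  proof (cases "p = []")
    case True
    then show ?thesis using Cons.prems by (intro exI[of _ "[]"] exI[of _ "c # z"]) auto
  next
    case False
    have "\<exists>p'. p = fib_morphism c @ p' \<and> fib_subst z = p' @ q"
      using Cons.prems False assms(2)
      by (cases c; cases p; cases "tl p") (auto simp: Cons_eq_append_conv)
    then obtain p' where p': "p = fib_morphism c @ p'" "fib_subst z = p' @ q" by blast
    from Cons.IH[OF p'(2)] obtain z1 z2
      where "z = z1 @ z2" "p' = fib_subst z1" "q = fib_subst z2" by blast
    then show ?thesis using p' by (intro exI[of _ "c # z1"] exI[of _ z2]) auto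
  qed
qed

lemma fib_subst_not_Lb: "fib_subst z \<noteq> Lb # r"
  by (cases z rule: list.exhaust; cases "hd z") auto

lemma fib_subst_LaLb: "fib_subst z = La # Lb # r \<Longrightarrow> \<exists>z'. z = La # z' \<and> fib_subst z' = r"
  by (cases z; cases "hd z") (auto simp: fib_subst_not_Lb)

lemma fib_subst_LaLa: "fib_subst z = La # La # r \<Longrightarrow> \<exists>z'. z = Lb # z' \<and> fib_subst z' = La # r"
  by (cases z; cases "hd z") auto

lemma fib_subst_inj: "fib_subst x = fib_subst y \<Longrightarrow> x = y"
proof (induction x arbitrary: y)
  case Nil
  then show ?case by (cases y; cases "hd y") auto
next
  case (Cons c x)
  then obtain d y' where y: "y = d # y'" by (cases y; cases c) auto
  then have "c = d"
    using Cons.prems by (cases c; cases d) (auto simp: fib_subst_not_Lb dest: sym)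
  then show ?case using Cons y by auto
qed

lemma fib_subst_no_LbLb: "fib_subst z \<noteq> p @ Lb # Lb # q"
proof
  assume "fib_subst z = p @ Lb # Lb # q"
  then show False
  proof (induction z arbitrary: p)
    case (Cons c z)
    then show ?case
      by (cases c; cases p; cases "tl p") (auto simp: fib_subst_not_Lb)
  qed auto
qed

lemma fib_approx_no_LbLb: "fib_approx k \<noteq> p @ Lb # Lb # q"
proof (cases k)
  case 0
  then show ?thesis by (cases p) (auto simp: fib_approx_0)
next
  case (Suc j)
  then show ?thesis using fib_subst_no_LbLb by (simp add: fib_approx_Suc)
qed

lemma fib_approx_no_LaLaLa: "fib_approx k \<noteq> p @ La # La # La # q"
proof
  assume eq: "fib_approx k = p @ La # La # La # q"
  then obtain j where k: "k = Suc j"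
    by (cases k; cases p) (auto simp: fib_approx_0)
  obtain z1 z2 where z: "fib_approx j = z1 @ z2" "fib_subst z2 = La # La # La # q"
    using fib_subst_cut[of "fib_approx j" p "La # La # La # q"] eq k by (auto simp: fib_approx_Suc)
  obtain z3 where z3: "z2 = Lb # z3" "fib_subst z3 = La # La # q" using fib_subst_LaLa z(2) by blast
  then obtain z4 where "z3 = Lb # z4" using fib_subst_LaLa by blast
  then show False using z z3 fib_approx_no_LbLb by auto
qed

lemma fib_approx_hd: "\<exists>r. fib_approx k = La # r"
  using fib_approx_prefix[of 0 k] by (auto simp: fib_approx_0 prefix_def)

section \<open>Squares are squares of conjugates of Fibonacci words\<close>

definition fib_conjugate :: "letter list \<Rightarrow> bool" where
  "fib_conjugate w \<longleftrightarrow> (\<exists>k i. i < length (fib_approx k) \<and> w = rotate i (fib_approx k))"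

lemma fib_conjugate_rotate:
  assumes "fib_conjugate w"
  shows "fib_conjugate (rotate j w)"
proof -
  obtain k i where w: "w = rotate i (fib_approx k)" using assms by (auto simp: fib_conjugate_def)
  let ?r = "(j + i) mod length (fib_approx k)"
  have "rotate j w = rotate ?r (fib_approx k)"
    using w by (simp add: rotate_rotate flip: rotate_conv_mod)
  moreover have "?r < length (fib_approx k)"
    using fib_approx_hd[of k] by auto
  ultimately show ?thesis unfolding fib_conjugate_def by blast
qed

lemma fib_conjugate_rotate_left: "fib_conjugate (u @ v) \<Longrightarrow> fib_conjugate (v @ u)"
  using fib_conjugate_rotate[of "u @ v" "length u"] by (simp add: rotate_append)

lemma fib_conjugate_subst:
  assumes "fib_conjugate w"
  shows "fib_conjugate (fib_subst w)"
proof -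
  obtain k i where "i < length (fib_approx k)" "w = rotate i (fib_approx k)"
    using assms by (auto simp: fib_conjugate_def)
  then have x: "fib_approx k = take i (fib_approx k) @ drop i (fib_approx k)"
    and w: "w = drop i (fib_approx k) @ take i (fib_approx k)"
    by (auto simp: rotate_drop_take)
  have "fib_approx (Suc k) = fib_subst (take i (fib_approx k)) @ fib_subst (drop i (fib_approx k))"
    by (metis x fib_approx_Suc map_append concat_append)
  moreover have "fib_conjugate (fib_approx (Suc k))"
    unfolding fib_conjugate_def using fib_approx_hd[of "Suc k"]
    by (intro exI[of _ "Suc k"] exI[of _ 0]) auto
  ultimately show ?thesis
    using fib_conjugate_rotate_left w by simp
qed

text \<open>
A square \<open>ww\<close> with \<open>w\<close> beginning with \<open>a\<close> resists desubstitution if \<open>w\<close> ends with \<open>a\<close> and \<open>ww\<close> is followed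
by \<open>b\<close>: the last \<open>a\<close> of the first \<open>w\<close> is the image of \<open>b\<close>, whereas the last \<open>a\<close> of the second \<open>w\<close> is
only half of the image \<open>ab\<close> of \<open>a\<close>. So the preimage is \<open>ybya\<close> instead of a square. If moreover the
square cannot be shifted to the left because it is not preceded by \<open>a\<close>, then the preimage is at the
beginning or preceded by \<open>a\<close>. The lemma says that this happens for a single short word only:
desubstituting \<open>ybya\<close> once more gives \<open>xaxb\<close>, and for nonempty \<open>x\<close> the absence of \<open>bb\<close> and \<open>aaa\<close>
forces \<open>x\<close> to end with \<open>a\<close>, then to begin with \<open>b\<close>, and then to be preceded by \<open>a\<close>, whose image
ends with \<open>b\<close> against the assumption on \<open>z1\<close>.
\<close>

lemma fib_approx_square_overhang:
  assumes z: "fib_approx k = z1 @ y @ [Lb] @ y @ [La] @ z2"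
    and y: "y \<noteq> []" and z1: "z1 = [] \<or> last z1 = La"
  shows "y = [La]"
proof -
  have last_y: "\<exists>y'. y = y' @ [La]"
  proof (cases y rule: rev_cases)
    case (snoc y' c)
    then show ?thesis using fib_approx_no_LbLb[of k "z1 @ y'" "y @ [La] @ z2"] z by (cases c) auto
  qed (use y in auto)
  then obtain y' where y': "y = y' @ [La]" by blast
  obtain j where k: "k = Suc j"
    using z y by (cases k) (auto simp: fib_approx_0 Cons_eq_append_conv)
  have y'_hd: "\<not> prefix [Lb] y'"
    using fib_approx_no_LbLb[of k "z1 @ y" "tl y' @ [La, La] @ z2"] z y'
    by (cases y') (auto simp: prefix_def)
  \<comment> \<open>Each of the following cuts is at a position followed by \<open>a\<close>;
      the letter that follows \<open>y'\<close> matters if \<open>y'\<close> is empty.\<close>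
  have eq: "fib_subst (fib_approx j) = z1 @ y' @ [La, Lb] @ y' @ [La] @ [La] @ z2"
    using z y' k by (simp add: fib_approx_Suc)
  have "\<not> prefix [Lb] (y' @ [La, Lb] @ y' @ [La, La] @ z2)"
    using y'_hd by (cases y') auto
  then obtain t1 s1 where s1: "fib_approx j = t1 @ s1" "z1 = fib_subst t1"
    "fib_subst s1 = y' @ [La, Lb] @ y' @ [La] @ [La] @ z2"
    using fib_subst_cut[OF eq] by auto
  obtain x s2 where s2: "s1 = x @ s2" "y' = fib_subst x"
    "fib_subst s2 = [La, Lb] @ y' @ [La] @ [La] @ z2"
    using fib_subst_cut[OF s1(3)] by auto
  obtain s3 where s3: "s2 = La # s3" "fib_subst s3 = y' @ [La] @ [La] @ z2"
    using fib_subst_LaLb[of s2] s2(3) by auto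
  obtain x' s4 where s4: "s3 = x' @ s4" "y' = fib_subst x'" "fib_subst s4 = [La] @ [La] @ z2"
    using fib_subst_cut[OF s3(2)] by auto
  have "x' = x" using s2(2) s4(2) fib_subst_inj by metis
  obtain s5 where s5: "s4 = Lb # s5"
    using fib_subst_LaLa[of s4] s4(3) by auto
  have t: "fib_approx j = t1 @ x @ [La] @ x @ [Lb] @ s5"
    using s1(1) s2(1) s3(1) s4(1) s5 \<open>x' = x\<close> by simp
  have "x = []"
  proof (rule ccontr)
    assume "x \<noteq> []"
    then obtain x1 c where x1: "x = x1 @ [c]" by (metis rev_exhaust)
    have c: "c = La"
      using fib_approx_no_LbLb[of j "t1 @ x @ [La] @ x1" s5] t x1 by (cases c) auto
    obtain d x2 where x2: "x = d # x2" using \<open>x \<noteq> []\<close> by (metis list.exhaust)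
    have "fib_approx j = t1 @ (x1 @ [c]) @ [La] @ (d # x2) @ [Lb] @ s5"
      using t x1 x2 by metis
    then have d: "d = Lb"
      using fib_approx_no_LaLaLa[of j "t1 @ x1" "x2 @ [Lb] @ s5"] c by (cases d) auto
    have "t1 \<noteq> []" using t x2 d fib_approx_hd[of j] by auto
    then obtain t2 e where t2: "t1 = t2 @ [e]" by (metis rev_exhaust)
    have "e = La"
      using fib_approx_no_LbLb[of j t2 "x2 @ [La] @ x @ [Lb] @ s5"] t x2 d t2 by (cases e) auto
    then have "last z1 = Lb" "z1 \<noteq> []" using s1(2) t2 by auto
    then show False using z1 by auto
  qed
  then show ?thesis using y' s2(2) by simp
qed

text \<open>
Induction by desubstitution: if \<open>w\<close> begins with \<open>a\<close> and \<open>ww\<close> ends at a boundary between images, then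
\<open>ww\<close> is the image of a square \<open>vv\<close> in the previous Fibonacci word, and the image of a conjugate is a
conjugate. Otherwise the square can be shifted by one letter to the left, which only rotates \<open>w\<close>, so
that this situation is reached; the exceptions are \<open>w = a\<close> and \<open>w = aba\<close>, which are Fibonacci words.
\<close>

lemma square_in_fib_approx_conjugate:
  assumes "fib_approx k = p @ w @ w @ q" and "w \<noteq> []"
  shows "fib_conjugate w"
  using assms
proof (induction k arbitrary: p w q)
  case 0
  then show ?case by (auto simp: fib_approx_0 Cons_eq_append_conv)
next
  case (Suc k)
  have desubst: "fib_conjugate u"
    if eq: "fib_approx (Suc k) = p @ u @ u @ q" and u: "\<exists>u'. u = La # u'" and q: "\<not> prefix [Lb] q"
    for p u q
  proof -
    obtain u' where u': "u = La # u'" using u by blast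
    have "fib_subst (fib_approx k) = p @ u @ u @ q"
      using eq by (simp add: fib_approx_Suc)
    then obtain z1 s1 where s1: "fib_approx k = z1 @ s1" "u @ u @ q = fib_subst s1"
      using fib_subst_cut u' by (metis Cons_prefix_Cons append_Cons letter.distinct(1))
    then obtain v s2 where s2: "s1 = v @ s2" "u = fib_subst v" "u @ q = fib_subst s2"
      using fib_subst_cut u' by (metis Cons_prefix_Cons append_Cons letter.distinct(1))
    then obtain v' s3 where s3: "s2 = v' @ s3" "u = fib_subst v'"
      using fib_subst_cut q by metis
    have "v' = v" using s2(2) s3(2) fib_subst_inj by metis
    then have "fib_approx k = z1 @ v @ v @ s3" using s1 s2 s3 by simp
    moreover have "v \<noteq> []" using s2(2) u' by auto
    ultimately show ?thesis using Suc.IH fib_conjugate_subst s2(2) by blast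
  qed
  have left: "fib_conjugate u"
    if eq: "fib_approx (Suc k) = (p @ [La]) @ u @ u @ q" and u: "u = u' @ [La]" for p u u' q
  proof -
    have "fib_conjugate ([La] @ u')"
      by (rule desubst[of p _ "La # q"]) (use eq u in auto)
    then show ?thesis using u fib_conjugate_rotate_left by blast
  qed
  obtain c w' where w: "w = c # w'" using Suc.prems(2) by (metis list.exhaust)
  show ?case
  proof (cases c)
    case Lb
    \<comment> \<open>Only \<open>a\<close> can precede the \<open>b\<close> at which each copy of \<open>w\<close> starts, so the square can be shifted left.\<close>
    obtain p' where p': "p = p' @ [La]"
    proof (cases p rule: rev_cases)
      case Nil
      then show ?thesis using Suc.prems(1) w Lb fib_approx_hd[of "Suc k"] by auto
    next
      case (snoc p' d)
      then show ?thesis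
        using that Suc.prems(1) w Lb fib_approx_no_LbLb[of "Suc k" p' "w' @ w @ q"] by (cases d) auto
    qed
    obtain w1 d where w1: "w = w1 @ [d]" using Suc.prems(2) by (metis rev_exhaust)
    have "d = La"
    proof (cases d)
      case Lb': Lb
      have "fib_approx (Suc k) = p @ w1 @ [d] @ c # w' @ q"
        using Suc.prems(1) w w1 by (metis append.assoc append_Cons)
      then show ?thesis using Lb Lb' fib_approx_no_LbLb[of "Suc k" "p @ w1" "w' @ q"] by auto
    qed simp
    then show ?thesis using left[of p' w q w1] Suc.prems(1) p' w1 by simp
  next
    case La
    show ?thesis
    proof (cases "prefix [Lb] q")
      case False
      then show ?thesis using desubst Suc.prems(1) w La by blast
    next
      case True
      then obtain q' where q': "q = Lb # q'" by (auto simp: prefix_def)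
      obtain w1 d where w1: "w = w1 @ [d]" using Suc.prems(2) by (metis rev_exhaust)
      have d: "d = La"
        using Suc.prems(1) w1 q' fib_approx_no_LbLb[of "Suc k" "p @ w @ w1" q'] by (cases d) auto
      show ?thesis
      proof (cases "p \<noteq> [] \<and> last p = La")
        case True
        then have "p = butlast p @ [La]" by (metis append_butlast_last_id)
        then show ?thesis using left[of "butlast p" w q w1] Suc.prems(1) w1 d by simp
      next
        case p: False
        show ?thesis
        proof (cases "w1 = []")
          case True
          have "fib_conjugate [La]"
            unfolding fib_conjugate_def
            by (intro exI[of _ 0]) (simp add: fib_approx_0)
          then show ?thesis using w1 d True by simp
        next
          case False
          have w1_hd: "\<exists>r. w1 = La # r" using False w w1 La by (cases w1) auto
          have eq: "fib_subst (fib_approx k) = p @ w @ w1 @ La # Lb # q'"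
            using Suc.prems(1) w1 d q' by (simp add: fib_approx_Suc)
          obtain z1 s1 where s1: "fib_approx k = z1 @ s1" "p = fib_subst z1"
              "w @ w1 @ La # Lb # q' = fib_subst s1"
            using fib_subst_cut[OF eq] w La by auto
          obtain v s2 where s2: "s1 = v @ s2" "w = fib_subst v" "w1 @ La # Lb # q' = fib_subst s2"
            using fib_subst_cut[OF s1(3)[symmetric]] w1_hd by auto
          obtain y s3 where s3: "s2 = y @ s3" "w1 = fib_subst y" "La # Lb # q' = fib_subst s3"
            using fib_subst_cut[OF s2(3)[symmetric]] by auto
          obtain s4 where s4: "s3 = La # s4" using fib_subst_LaLb s3(3) by metis
          have "fib_subst v = fib_subst (y @ [Lb])" using s2(2) w1 d s3(2) by simp
          then have v: "v = y @ [Lb]" by (rule fib_subst_inj)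
          \<comment> \<open>No shift to the left is possible here, which is what restricts \<open>z1\<close>.\<close>
          have "y = [La]"
          proof (rule fib_approx_square_overhang)
            show "fib_approx k = z1 @ y @ [Lb] @ y @ [La] @ s4"
              using s1(1) s2(1) s3(1) s4 v by simp
            show "y \<noteq> []" using False s3(2) by auto
            show "z1 = [] \<or> last z1 = La"
            proof (cases z1 rule: rev_cases)
              case (snoc z' e)
              then show ?thesis using p s1(2) by (cases e) auto
            qed simp
          qed
          then have "w = fib_approx 2"
            using s2(2) v by (simp add: numeral_2_eq_2 fib_approx_Suc fib_approx_0)
          then show ?thesis
            unfolding fib_conjugate_def
            by (intro exI[of _ 2] exI[of _ 0]) (simp add: length_fib_approx numeral_eq_Suc)
        qed
      qed
    qed
  qed
qed

section \<open>Factors of the infinite word by position\<close>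

abbreviation fib_letter :: "nat \<Rightarrow> letter" where
  "fib_letter i \<equiv> fib_word !! i"

definition fib_factor :: "nat \<Rightarrow> nat \<Rightarrow> letter list" where
  "fib_factor s l = map fib_letter [s..<s + l]"

lemma length_fib_factor [simp]: "length (fib_factor s l) = l"
  by (simp add: fib_factor_def)

lemma nth_fib_factor [simp]: "j < l \<Longrightarrow> fib_factor s l ! j = fib_letter (s + j)"
  by (simp add: fib_factor_def)

lemma fib_factor_add: "fib_factor s (l + l') = fib_factor s l @ fib_factor (s + l) l'"
  unfolding fib_factor_def by (metis add.assoc le_add1 map_append upt_add_eq_append)

lemma fib_letter_approx: "j < length (fib_approx k) \<Longrightarrow> fib_letter j = fib_approx k ! j"
  using fixed_point_snth[OF fib_word_fixed_point] fib_approx_nth fib_approx_length by metis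

lemma fib_letter_block:
  assumes "fib_approx K = u @ v @ t" and "j < length v"
  shows "fib_letter (length u + j) = v ! j"
  using assms by (subst fib_letter_approx[of _ K]) (auto simp: nth_append)

lemma stake_fib_word: "stake n fib_word = fib_factor 0 n"
  by (simp add: stake_nth fib_factor_def list_eq_iff_nth_eq)

lemma sublist_stake_fib_word_iff:
  "sublist u (stake n fib_word) \<longleftrightarrow> (\<exists>s. s + length u \<le> n \<and> u = fib_factor s (length u))"
proof
  assume "sublist u (stake n fib_word)"
  then obtain p q where eq: "fib_factor 0 n = p @ u @ q"
    by (auto simp: sublist_def stake_fib_word)
  then have n: "n = length p + (length u + length q)" by (metis length_append length_fib_factor)
  have "fib_factor 0 n = fib_factor 0 (length p) @ fib_factor (length p) (length u)
      @ fib_factor (length p + length u) (length q)"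
    unfolding n by (simp only: fib_factor_add add_0 append_assoc)
  then have "u = fib_factor (length p) (length u)"
    using eq by (metis append_eq_append_conv length_fib_factor)
  then show "\<exists>s. s + length u \<le> n \<and> u = fib_factor s (length u)" using n by (metis add.assoc le_add1)
next
  assume "\<exists>s. s + length u \<le> n \<and> u = fib_factor s (length u)"
  then obtain s where s: "s + length u \<le> n" "u = fib_factor s (length u)" by blast
  have "n = s + (length u + (n - s - length u))" using s(1) by simp
  then have "fib_factor 0 n = fib_factor 0 s @ u @ fib_factor (s + length u) (n - s - length u)"
    using s(2) by (metis fib_factor_add add_0)
  then show "sublist u (stake n fib_word)" by (auto simp: sublist_def stake_fib_word)
qed

lemma fib_factor_square_iff:
  "fib_factor (s + p) p = fib_factor s p \<longleftrightarrow> (\<forall>j\<in>{s..<s + p}. fib_letter (j + p) = fib_letter j)"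
proof -
  have "fib_factor (s + p) p = fib_factor s p \<longleftrightarrow> (\<forall>i<p. fib_letter (s + p + i) = fib_letter (s + i))"
    by (auto simp: list_eq_iff_nth_eq)
  also have "\<dots> \<longleftrightarrow> (\<forall>j\<in>{s..<s + p}. fib_letter (j + p) = fib_letter j)"
  proof safe
    fix j assume "\<forall>i<p. fib_letter (s + p + i) = fib_letter (s + i)" "j \<in> {s..<s + p}"
    then show "fib_letter (j + p) = fib_letter j"
      by (auto dest!: spec[of _ "j - s"] simp: add_ac)
  next
    fix i assume "\<forall>j\<in>{s..<s + p}. fib_letter (j + p) = fib_letter j" "i < p"
    then show "fib_letter (s + p + i) = fib_letter (s + i)"
      by (auto dest!: bspec[of _ _ "s + i"] simp: add_ac)
  qed
  finally show ?thesis .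
qed

lemma square_in_fib_prefix_iff:
  "w \<noteq> [] \<and> sublist (w @ w) (stake n fib_word) \<longleftrightarrow>
     (\<exists>s p. p > 0 \<and> s + 2 * p \<le> n \<and> w = fib_factor s p \<and>
            (\<forall>j\<in>{s..<s + p}. fib_letter (j + p) = fib_letter j))"
    (is "?l \<longleftrightarrow> ?r")
proof
  assume ?l
  then obtain s where s: "s + length (w @ w) \<le> n" "w @ w = fib_factor s (length w + length w)"
    by (auto simp: sublist_stake_fib_word_iff)
  then have "w = fib_factor s (length w)" "w = fib_factor (s + length w) (length w)"
    by (simp_all add: fib_factor_add)
  then show ?r using s \<open>?l\<close>
    by (intro exI[of _ s] exI[of _ "length w"]) (auto simp flip: fib_factor_square_iff)
next
  assume ?r
  then obtain s p where s: "p > 0" "s + 2 * p \<le> n" "w = fib_factor s p"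
    "fib_factor (s + p) p = fib_factor s p" by (auto simp flip: fib_factor_square_iff)
  then have "w @ w = fib_factor s (p + p)" by (simp add: fib_factor_add)
  then show ?l using s sublist_stake_fib_word_iff
    by (metis length_fib_factor length_greater_0_conv mult_2)
qed

text \<open>
Moving a window of length \<open>p\<close> along a stretch of period \<open>p\<close> rotates its content.
\<close>

lemma fib_factor_rotate:
  assumes "\<And>j. j < i \<Longrightarrow> fib_letter (s + j + p) = fib_letter (s + j)" and "i < p"
  shows "fib_factor (s + i) p = rotate i (fib_factor s p)"
proof (rule nth_equalityI)
  fix j assume "j < length (fib_factor (s + i) p)"
  then have j: "j < p" by simp
  show "fib_factor (s + i) p ! j = rotate i (fib_factor s p) ! j"
  proof (cases "i + j < p")
    case True
    then show ?thesis using j by (simp add: nth_rotate add.assoc)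
  next
    case False
    then have "(i + j) mod p = i + j - p" using j assms(2) by (simp add: mod_if)
    then show ?thesis using False j assms(1)[of "i + j - p"] assms(2)
      by (simp add: nth_rotate add.assoc)
  qed
qed simp

section \<open>The first occurrence of each square\<close>

text \<open>
With period \<open>f\<^sub>k\<close> the infinite word starts to repeat itself, and the repetition breaks at exactly the
last two positions before \<open>f\<^sub>k\<^sub>+\<^sub>1\<close>. For \<open>k > 0\<close> the comparison is that of \<open>x\<^sub>k x\<^sub>k\<^sub>-\<^sub>1\<close>, a prefix of the infinite
word, with \<open>x\<^sub>k\<^sub>-\<^sub>1 x\<^sub>k\<close>, which occurs at position \<open>f\<^sub>k\<close>.
\<close>

lemma fib_word_initial_run:
  assumes "j < fib (k + 3)"
  shows "fib_letter (j + fib (k + 2)) = fib_letter j \<longleftrightarrow> j + 2 < fib (k + 3)"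
proof (cases k)
  case 0
  have "fib_approx 2 = [La, Lb, La]"
    by (simp add: numeral_2_eq_2 fib_approx_append fib_approx_0 fib_approx_1)
  then have "fib_letter 0 = La" "fib_letter 1 = Lb" "fib_letter 2 = La"
    using fib_letter_approx[of 0 2] fib_letter_approx[of 1 2] fib_letter_approx[of 2 2]
    by simp_all
  then show ?thesis using assms 0 by (auto simp: numeral_eq_Suc less_Suc_eq)
next
  case (Suc i)
  obtain c u v where neq: "u \<noteq> v"
    and uv: "fib_approx k @ fib_approx i = c @ [u, v]"
    and vu: "fib_approx i @ fib_approx k = c @ [v, u]"
    using fib_approx_almost_commute[of i] Suc by blast
  have 1: "fib_approx (Suc k) = [] @ (c @ [u, v]) @ []"
    using uv Suc by (simp add: fib_approx_append)
  have "fib_approx (Suc (Suc (Suc k))) = fib_approx k @ (fib_approx i @ fib_approx k) @ fib_approx (Suc k)"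
    by (simp add: Suc fib_approx_append)
  then have 2: "fib_approx (Suc (Suc (Suc k))) = fib_approx k @ (c @ [v, u]) @ fib_approx (Suc k)"
    by (simp only: vu)
  have len: "length c + 2 = fib (k + 3)"
    using arg_cong[OF 1, of length] by (simp add: length_fib_approx numeral_eq_Suc)
  have "fib_letter j = (c @ [u, v]) ! j"
    using fib_letter_block[OF 1, of j] assms len by simp
  moreover have "fib_letter (j + fib (k + 2)) = (c @ [v, u]) ! j"
    using fib_letter_block[OF 2, of j] assms len by (simp add: length_fib_approx add.commute)
  moreover have "j < length c \<or> j = length c \<or> j = length c + 1" using assms len by linarith
  ultimately show ?thesis using len neq by (auto simp: nth_append)
qed

text \<open>
From position \<open>f\<^sub>k\<^sub>+\<^sub>1\<close> on there is a stretch of period \<open>f\<^sub>k\<close> that is long enough for the squares of all \<open>f\<^sub>k\<close>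
rotations of \<open>x\<^sub>k\<close>: the products \<open>x\<^sub>k x\<^sub>k\<^sub>+\<^sub>1\<close> and \<open>x\<^sub>k\<^sub>+\<^sub>1 x\<^sub>k\<close> occur at the positions \<open>f\<^sub>k\<^sub>+\<^sub>1\<close> and
\<open>f\<^sub>k\<^sub>+\<^sub>1 + f\<^sub>k\<close>.
\<close>

lemma fib_word_second_run:
  assumes "j + 2 < fib (k + 3) + fib (k + 2)"
  shows "fib_letter (fib (k + 3) + j + fib (k + 2)) = fib_letter (fib (k + 3) + j)"
proof -
  obtain c u v where uv: "fib_approx (Suc k) @ fib_approx k = c @ [u, v]"
    and vu: "fib_approx k @ fib_approx (Suc k) = c @ [v, u]"
    using fib_approx_almost_commute[of k] by blast
  \<comment> \<open>The smallest Fibonacci word that contains both occurrences.\<close>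
  let ?K = "Suc (Suc (Suc (Suc k)))"
  have K: "fib_approx ?K = fib_approx (Suc k) @ fib_approx k @ fib_approx (Suc k) @
      fib_approx (Suc k) @ fib_approx k"
    by (simp add: fib_approx_append)
  have 1: "fib_approx ?K = fib_approx (Suc k) @ (c @ [v, u]) @ fib_approx (Suc k) @ fib_approx k"
    using K vu by simp
  obtain ys where "fib_approx (Suc k) = fib_approx k @ ys"
    using fib_approx_step by blast
  then have "fib_approx (Suc k) @ fib_approx (Suc k) = c @ [u, v] @ ys"
    using uv by (metis append.assoc)
  then have 2: "fib_approx ?K = (fib_approx (Suc k) @ fib_approx k) @ c @ ([u, v] @ ys @ fib_approx k)"
    using K by simp
  have len: "length c + 2 = fib (k + 3) + fib (k + 2)"
    using arg_cong[OF uv, of length] by (simp add: length_fib_approx numeral_eq_Suc)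
  then have j: "j < length c" using assms by simp
  have "fib_letter (fib (k + 3) + j) = (c @ [v, u]) ! j"
    using fib_letter_block[OF 1, of j] j by (simp add: length_fib_approx numeral_eq_Suc)
  moreover have "fib_letter (fib (k + 3) + fib (k + 2) + j) = c ! j"
    using fib_letter_block[OF 2, of j] j by (simp add: length_fib_approx numeral_eq_Suc)
  ultimately show ?thesis using j by (simp add: nth_append add_ac)
qed

lemma fib_factor_0_fib: "fib_factor 0 (fib (k + 2)) = fib_approx k"
  by (rule nth_equalityI) (auto simp: length_fib_approx fib_letter_approx)

lemma fib_factor_at_second_run: "fib_factor (fib (k + 3)) (fib (k + 2)) = fib_approx k"
proof (rule nth_equalityI)
  fix j assume "j < length (fib_factor (fib (k + 3)) (fib (k + 2)))"
  then have j: "j < length (fib_approx k)" by (simp add: length_fib_approx)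
  have "fib_approx (Suc (Suc k)) = fib_approx (Suc k) @ fib_approx k @ []"
    by (simp add: fib_approx_append)
  from fib_letter_block[OF this j]
  show "fib_factor (fib (k + 3)) (fib (k + 2)) ! j = fib_approx k ! j"
    using j by (simp add: length_fib_approx numeral_eq_Suc)
qed (simp add: length_fib_approx)

text \<open>
The length of the shortest prefix that contains the square of the \<open>i\<close>-th rotation of \<open>x\<^sub>k\<close>,
for \<open>i < f\<^sub>k\<close>. This square first starts at \<open>i\<close> if it fits into the initial stretch of period \<open>f\<^sub>k\<close>, and
at \<open>f\<^sub>k\<^sub>+\<^sub>1 + i\<close> otherwise.
\<close>

definition first_square_end :: "nat \<Rightarrow> nat \<Rightarrow> nat" where
  "first_square_end k i =
     (if i + 1 < fib (k + 1) then 2 * fib (k + 2) + i else fib (k + 3) + 2 * fib (k + 2) + i)"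

lemma fib_plus_3: "fib (k + 3) = fib (k + 2) + fib (k + 1)"
  by (simp add: numeral_eq_Suc)

text \<open>
That the squares occur where \<^const>\<open>first_square_end\<close> says is read off from the two periodic stretches.
Conversely, the first half of a square with root of length \<open>f\<^sub>k\<close> contains neither of the two positions
before \<open>f\<^sub>k\<^sub>+\<^sub>1\<close>. Hence the square lies in the initial stretch, or begins within the
first \<open>f\<^sub>k\<close> positions of the second one, or begins so late that the square of every rotation has already
occurred before its end; in this last case the classification of the roots is needed for more than
their length.
\<close>

lemma squares_in_fib_prefix:
  "{w. w \<noteq> [] \<and> sublist (w @ w) (stake n fib_word)} =
   (\<lambda>(k, i). rotate i (fib_approx k)) ` {(k, i). i < fib (k + 2) \<and> first_square_end k i \<le> n}"
    (is "?S = ?R")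
proof (intro equalityI subsetI)
  fix w assume "w \<in> ?R"
  then obtain k i where i: "i < fib (k + 2)" "first_square_end k i \<le> n"
    and w: "w = rotate i (fib_approx k)" by auto
  let ?p = "fib (k + 2)"
  show "w \<in> ?S"
  proof (cases "i + 1 < fib (k + 1)")
    case True
    have run: "fib_letter (j + ?p) = fib_letter j" if "j < i + ?p" for j
      using fib_word_initial_run[of j k] that True fib_plus_3[of k] by simp
    have "w = fib_factor i ?p"
      using fib_factor_rotate[of i 0 ?p] run i(1) w fib_factor_0_fib[of k] by simp
    then show ?thesis
      unfolding mem_Collect_eq square_in_fib_prefix_iff
      using run i True by (intro exI[of _ i] exI[of _ ?p]) (auto simp: first_square_end_def)
  next
    case False
    let ?q = "fib (k + 3)"
    have run: "fib_letter (?q + j + ?p) = fib_letter (?q + j)" if "j < i + ?p" for j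
      using fib_word_second_run[of j k] that i(1) fib_plus_3[of k] fib_neq_0_nat[of "k + 1"] by simp
    have "w = fib_factor (?q + i) ?p"
      using fib_factor_rotate[of i ?q ?p] run i(1) w fib_factor_at_second_run[of k] by simp
    moreover have "fib_letter (j + ?p) = fib_letter j" if "j \<in> {?q + i..<?q + i + ?p}" for j
    proof -
      have "?q + (j - ?q) = j" "j - ?q < i + ?p"
        using that unfolding atLeastLessThan_iff by linarith+
      then show ?thesis using run[of "j - ?q"] by simp
    qed
    ultimately show ?thesis
      unfolding mem_Collect_eq square_in_fib_prefix_iff
      using i False by (intro exI[of _ "?q + i"] exI[of _ ?p]) (auto simp: first_square_end_def)
  qed
next
  fix w assume w: "w \<in> ?S"
  then obtain s p where s: "p > 0" "s + 2 * p \<le> n" "w = fib_factor s p"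
    and per: "\<And>j. j \<in> {s..<s + p} \<Longrightarrow> fib_letter (j + p) = fib_letter j"
    unfolding mem_Collect_eq square_in_fib_prefix_iff by blast
  have "prefix (stake n fib_word) (fib_approx n)"
  proof -
    have "stake n fib_word = take n (fib_approx n)"
      using fib_approx_length[of n] by (intro nth_equalityI) (auto simp: fib_letter_approx)
    then show ?thesis by (simp add: take_is_prefix)
  qed
  with w have "sublist (w @ w) (fib_approx n)"
    using prefix_imp_sublist sublist_order.order_trans by blast
  then obtain a b where "fib_approx n = a @ w @ w @ b" by (auto simp: sublist_def)
  then have "fib_conjugate w" using square_in_fib_approx_conjugate w by blast
  then obtain k i where i: "i < fib (k + 2)" "w = rotate i (fib_approx k)"
    by (auto simp: fib_conjugate_def length_fib_approx)
  have p: "p = fib (k + 2)"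
    using s(3) i(2) by (metis length_fib_factor length_rotate length_fib_approx)
  let ?q = "fib (k + 3)"
  consider "s + p + 1 < ?q" | "s + p + 1 \<ge> ?q" "s < ?q" | "s \<ge> ?q" "s < ?q + p" | "s \<ge> ?q + p"
    by linarith
  then have "\<exists>i<fib (k + 2). w = rotate i (fib_approx k) \<and> first_square_end k i \<le> n"
  proof cases
    case 1
    then have "s + 1 < fib (k + 1)" using p fib_plus_3 by simp
    moreover have "s < p" using calculation p fib_mono[of "k + 1" "k + 2"] by linarith
    moreover have "fib_factor s p = rotate s (fib_factor 0 p)"
      using fib_factor_rotate[of s 0 p] fib_word_initial_run[of _ k] 1 p \<open>s < p\<close> by simp
    ultimately show ?thesis
      using s p fib_factor_0_fib[of k] by (intro exI[of _ s]) (simp add: first_square_end_def)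
  next
    case 2
    have "?q \<ge> 2" using fib_mono[of 3 "k + 3"] by (simp add: numeral_eq_Suc)
    \<comment> \<open>Of the two breaks, one lies in the range of comparisons of the square.\<close>
    define j where "j = (if s + 2 \<le> ?q then ?q - 2 else ?q - 1)"
    have j: "j \<in> {s..<s + p}" "j < ?q" "\<not> j + 2 < ?q"
      using 2 \<open>?q \<ge> 2\<close> s(1) by (auto simp: j_def)
    then show ?thesis using per[OF j(1)] fib_word_initial_run[of j k] p by simp
  next
    case 3
    define i' where "i' = s - ?q"
    have i': "i' < p" "s = ?q + i'" using 3 by (auto simp: i'_def)
    have "fib_factor s p = rotate i' (fib_factor ?q p)"
      unfolding i'(2)
    proof (rule fib_factor_rotate)
      fix j assume "j < i'"
      then show "fib_letter (?q + j + p) = fib_letter (?q + j)"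
        using fib_word_second_run[of j k] i' p fib_plus_3[of k] by simp
    qed (use i' in simp)
    then show ?thesis
      using s p i' fib_factor_at_second_run[of k]
      by (intro exI[of _ i']) (simp add: first_square_end_def)
  next
    case 4
    then show ?thesis using i s p by (intro exI[of _ i]) (simp add: first_square_end_def)
  qed
  then show "w \<in> ?R" by force
qed

section \<open>Counting\<close>

lemma fib_strict_mono: "i < j \<Longrightarrow> fib (i + 2) < fib (j + 2)"
proof (induction rule: strict_inc_induct)
  case (base i)
  then show ?case using fib_neq_0_nat[of "Suc i"] by simp
next
  case (step i)
  then show ?case using fib_mono[of "i + 2" "Suc i + 2"] by linarith
qed

lemma num_squares_eq_card:
  "num_squares n = card {(k, i). i < fib (k + 2) \<and> first_square_end k i \<le> n}"
proof -
  have "inj_on (\<lambda>(k, i). rotate i (fib_approx k)) {(k, i). i < fib (k + 2)}"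
  proof (rule inj_onI, clarify)
    fix k i k' i'
    assume i: "i < fib (k + 2)" "i' < fib (k' + 2)"
      and eq: "rotate i (fib_approx k) = rotate i' (fib_approx k')"
    have "fib (k + 2) = fib (k' + 2)"
      using arg_cong[OF eq, of length] by (simp add: length_fib_approx)
    then have "k = k'" using fib_strict_mono by (metis linorder_neqE_nat less_irrefl)
    then show "k = k' \<and> i = i'"
      using rotate_fib_approx_inj[of i k i'] i eq by (simp add: length_fib_approx)
  qed
  then show ?thesis
    unfolding num_squares_def squares_in_fib_prefix
    by (intro card_image) (auto elim: inj_on_subset)
qed

lemma sum_fib_eq: "(\<Sum>k<M. fib (k + 2)) + 2 = fib (M + 3)"
  by (induction M) (simp_all add: numeral_eq_Suc)

lemma first_square_end_ge: "2 * fib (k + 2) + i \<le> first_square_end k i"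
  by (simp add: first_square_end_def)

text \<open>
Let \<open>m = M + 1\<close>, so that \<open>n\<close> lies between \<open>2 f\<^sub>m\<close> and \<open>2 f\<^sub>m\<^sub>+\<^sub>1\<close>. All squares with roots of length \<open>f\<^sub>k\<close>
for \<open>k < m - 1\<close> have occurred, and none for \<open>k > m\<close>. As \<open>n\<close> grows, every step first completes one
square with root of length \<open>f\<^sub>m\<close>, until these are interrupted; from then on every step completes one of
the squares with root of length \<open>f\<^sub>m\<^sub>-\<^sub>1\<close> that were missing; when all of these are present, nothing new
appears before \<open>2 f\<^sub>m\<^sub>+\<^sub>1\<close>.
\<close>

lemma num_squares_window:
  assumes "2 * fib (M + 3) \<le> n" and "n < 2 * fib (M + 4)"
  shows "int (num_squares n) =
    (if n < fib (M + 4) + 2 * fib (M + 2) then int n - fib (M + 2) - 2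
     else int (fib (M + 4)) + fib (M + 2) - 3)"
proof -
  define A where "A k = {i. i < fib (k + 2) \<and> first_square_end k i \<le> n}" for k
  define a b where "a = fib (M + 1)" and "b = fib (M + 2)"
  have fibs: "fib (M + 3) = a + b" "fib (M + 4) = a + 2 * b" "fib (M + 1 + 1) = b"
      "fib (M + 1 + 2) = a + b" "fib (M + 1 + 3) = a + 2 * b" "fib (M + 1) = a" "fib (M + 2) = b"
    by (simp_all add: a_def b_def numeral_eq_Suc)
  have pos: "0 < a" "a \<le> b" "b \<le> 2 * a"
    using fib_mono[of M "M + 1"] by (simp_all add: a_def b_def fib_neq_0_nat)
  have n: "2 * a + 2 * b \<le> n" "n < 2 * a + 4 * b" using assms fibs by simp_all
  have fin: "finite (A k)" for k by (simp add: A_def)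
  have late: "A k = {}" if "k > M + 1" for k
  proof -
    have "a + 2 * b \<le> fib (k + 2)"
      using that fib_mono[of "M + 3" "k + 1"] fib_mono[of "M + 4" "k + 2"] fibs(2) by linarith
    then have "n < first_square_end k i" for i
      using first_square_end_ge[of k i] n by linarith
    then show ?thesis by (auto simp: A_def not_le)
  qed
  have early: "A k = {..<fib (k + 2)}" if "k < M" for k
  proof -
    have "fib (k + 2) \<le> a" "fib (k + 3) \<le> b"
      using that fib_mono[of "k + 2" "M + 1"] fib_mono[of "k + 3" "M + 2"] fibs by simp_all
    then show ?thesis using n pos by (auto simp: A_def first_square_end_def)
  qed
  \<comment> \<open>Below \<open>a - 1\<close> are the rotations whose squares fit into the initial stretch; they come early.\<close>
  have "i \<in> A M \<longleftrightarrow> i < b \<and> (if i + 1 < a then 2 * b + i else a + b + 2 * b + i) \<le> n" for i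
    by (simp only: A_def mem_Collect_eq first_square_end_def fibs)
  then have "i \<in> A M \<longleftrightarrow> i < max (a - 1) (min b (n + 1 - (a + 3 * b)))" for i
    using n pos by (cases "i + 1 < a") (simp_all add: less_max_iff_disj, linarith+)
  then have AM: "A M = {..<max (a - 1) (min b (n + 1 - (a + 3 * b)))}"
    by blast
  have "i \<in> A (M + 1) \<longleftrightarrow> i < a + b \<and>
      (if i + 1 < b then 2 * (a + b) + i else a + 2 * b + 2 * (a + b) + i) \<le> n" for i
    by (simp only: A_def mem_Collect_eq first_square_end_def fibs)
  then have "i \<in> A (M + 1) \<longleftrightarrow> i < min (b - 1) (n + 1 - 2 * (a + b))" for i
    using n pos by (cases "i + 1 < b") (simp_all, linarith+)
  then have AM1: "A (M + 1) = {..<min (b - 1) (n + 1 - 2 * (a + b))}"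
    by blast
  have "k < M + 2" if "i \<in> A k" for k i
    using late[of k] that
    by (metis empty_iff add_Suc_right less_Suc_eq_le not_le nat_1_add_1 Suc_eq_plus1)
  then have "{(k, i). i < fib (k + 2) \<and> first_square_end k i \<le> n} = Sigma {..<M + 2} A"
    unfolding A_def by blast
  then have "num_squares n = (\<Sum>k<M + 2. card (A k))"
    using fin by (simp add: num_squares_eq_card)
  also have "\<dots> = (\<Sum>k<M. card (A k)) + card (A M) + card (A (M + 1))" by simp
  also have "(\<Sum>k<M. card (A k)) = (\<Sum>k<M. fib (k + 2))"
    by (rule sum.cong) (auto simp: early)
  finally have total: "num_squares n + 2 = a + b + max (a - 1) (min b (n + 1 - (a + 3 * b)))
      + min (b - 1) (n + 1 - 2 * (a + b))"
    unfolding AM AM1 card_lessThan using sum_fib_eq[of M] fibs(1) by linarith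
  consider "n + 2 \<le> 2 * a + 3 * b" | "n + 2 > 2 * a + 3 * b" "n < a + 4 * b" | "n \<ge> a + 4 * b"
    by linarith
  then have "int (num_squares n) =
      (if n < a + 2 * b + 2 * b then int n - b - 2 else int (a + 2 * b) + b - 3)"
  proof cases
    case 1
    have "max (a - 1) (min b (n + 1 - (a + 3 * b))) = a - 1"
      using 1 n pos by linarith
    moreover have "min (b - 1) (n + 1 - 2 * (a + b)) = n + 1 - 2 * (a + b)"
      by (rule min_absorb2) (use 1 in simp)
    ultimately show ?thesis using 1 n pos total by simp
  next
    case 2
    have "max (a - 1) (min b (n + 1 - (a + 3 * b))) = n + 1 - (a + 3 * b)"
      using 2 n pos by linarith
    moreover have "min (b - 1) (n + 1 - 2 * (a + b)) = b - 1"
      by (rule min_absorb1) (use 2 n pos in simp)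
    ultimately show ?thesis using 2 n pos total by simp
  next
    case 3
    have "max (a - 1) (min b (n + 1 - (a + 3 * b))) = b"
      using 3 n pos by linarith
    moreover have "min (b - 1) (n + 1 - 2 * (a + b)) = b - 1"
      by (rule min_absorb1) (use 3 n pos in simp)
    ultimately show ?thesis using 3 n pos total by simp
  qed
  then show ?thesis unfolding fibs .
qed

lemma num_squares_small: "n \<le> 3 \<Longrightarrow> num_squares n = 0"
proof -
  assume "n \<le> 3"
  have "first_square_end k i > 3" for k i
  proof (cases k)
    case (Suc j)
    then show ?thesis
      using first_square_end_ge[of k i] fib_mono[of 3 "k + 2"] by (simp add: numeral_eq_Suc)
  qed (simp add: first_square_end_def numeral_eq_Suc)
  then have "\<not> first_square_end k i \<le> n" for k i
    using \<open>n \<le> 3\<close> by (metis le_trans not_le)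
  then show ?thesis by (simp add: num_squares_eq_card)
qed

theorem theorem4p3:
  fixes n :: nat and m :: int
  assumes "n \<ge> 1"
    and "m \<ge> -2"
    and "2 * fibn m \<le> int n"
    and "int n < 2 * fibn (m + 1)"
  shows "(n \<ge> 3 \<longrightarrow>
           int (num_squares n) =
             (if int n \<le> fibn (m + 1) + 2 * fibn (m - 1) - 1
              then int n - fibn (m - 1) - 2
              else fibn (m + 1) + fibn (m - 1) - 3)) \<and>
         (n \<in> {1, 2} \<longrightarrow> num_squares n = 0)"
proof (cases "n \<ge> 4")
  case True
  have "m \<ge> 1"
  proof (rule ccontr)
    assume "\<not> m \<ge> 1"
    then have "nat (m + 1 + 2) \<le> 3" by simp
    then have "fib (nat (m + 1 + 2)) \<le> fib 3" by (rule fib_mono)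
    then show False using assms(4) True by (simp add: fibn_def numeral_eq_Suc)
  qed
  then obtain M where M: "m = int M + 1"
    by (metis nonneg_int_cases add.commute diff_add_cancel diff_ge_0_iff_ge)
  have idx: "nat (m + 2) = M + 3" "nat (m + 1 + 2) = M + 4" "nat (m - 1 + 2) = M + 2"
    using M by auto
  have "2 * fib (M + 3) \<le> n" "n < 2 * fib (M + 4)"
    using assms(3,4) by (simp_all only: fibn_def idx)
  from num_squares_window[OF this] show ?thesis
    using True unfolding fibn_def idx by auto
next
  case False
  then have zero: "num_squares n = 0" by (simp add: num_squares_small)
  show ?thesis
  proof (cases "n = 3")
    case True
    have "m = 0"
    proof (rule ccontr)
      assume "m \<noteq> 0"
      then consider "nat (m + 1 + 2) \<le> 2" | "nat (m + 2) \<ge> 3" by linarith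
      then show False
      proof cases
        case 1
        then show False using fib_mono[OF 1] assms(4) True by (simp add: fibn_def)
      next
        case 2
        then show False using fib_mono[OF 2] assms(3) True by (simp add: fibn_def numeral_eq_Suc)
      qed
    qed
    then show ?thesis using True zero by (simp add: fibn_def numeral_eq_Suc)
  qed (use False zero in auto)
qed

end
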